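(* Let $A=\{a_n\}_{n\in\mathbb Z}\subset\mathbb R$ be an almost periodic set of density $d$ such that $a_n\le a_{n+1}$ for all $n\in\mathbb Z$. Then there is an almost periodic mapping $\phi:\mathbb Z\to\mathbb R$ such that $$a_n=\frac{n}{d}+\phi(n)\qquad\text{for all } n\in\mathbb Z.$$
   Context: A discrete locally finite multiset $A=\{a_n\}_{n\in\mathbb Z}\subset\mathbb R$ (every bounded set contains $a_n$ for only finitely many indices $n$; a point of multiplicity $c$ occurs $c$ times in the sequence) is called an almost periodic set if for every $\varepsilon>0$ there is $L_\varepsilon>0$ such that the set $$E_\varepsilon=\{\tau\in\mathbb R:\ \text{there is a bijection }\sigma:\mathbb Z\to\mathbb Z\text{ with }\sup_n|a_n+\tau-a_{\sigma(n)}|<\varepsilon\}$$ intersects every interval $(x,x+L_\varepsilon)$, $x\in\mathbb R$. The density of an almost periodic set $A\subset\mathbb R$ is the number $d=\lim_{l(I)\to\infty}\frac{\#(A\cap I)}{l(I)}$, where $I$ runs over half-intervals of length $l(I)$ and $\#(A\cap I)$ counts points with multiplicity; this limit exists (uniformly in the position of $I$) and is strictly positive. A mapping $\phi:\mathbb Z\to\mathbb R$ is almost periodic if for every $\varepsilon>0$ the set of integers $h$ with $\sup_{n\in\mathbb Z}|\phi(n+h)-\phi(n)|<\varepsilon$ is relatively dense, i.e. there is $L>0$ such that this set intersects every interval $(x,x+L)$, $x\in\mathbb R$. *)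

theory Defs
  imports "HOL-Analysis.Analysis"
begin

text \<open>
  A multiset of reals is represented by an enumeration \<open>a :: int \<Rightarrow> real\<close>: a point of
  multiplicity \<open>c\<close> is the value of \<open>a\<close> at exactly \<open>c\<close> indices, so counting indices is
  counting points with multiplicity.
  Suprema are taken in \<^typ>\<open>ereal\<close>, so that the supremum of an unbounded family is \<open>\<infinity>\<close>.
\<close>

definition locally_finite_seq :: "(int \<Rightarrow> real) \<Rightarrow> bool" where
  "locally_finite_seq a \<longleftrightarrow> (\<forall>B. bounded B \<longrightarrow> finite {n. a n \<in> B})"

definition relatively_dense :: "real set \<Rightarrow> bool" where
  "relatively_dense E \<longleftrightarrow> (\<exists>L>0. \<forall>x. E \<inter> {x<..<x + L} \<noteq> {})"

definition set_almost_periods :: "(int \<Rightarrow> real) \<Rightarrow> real \<Rightarrow> real set" where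
  "set_almost_periods a \<epsilon> =
    {\<tau>. \<exists>\<sigma> :: int \<Rightarrow> int. bij \<sigma> \<and> (SUP n. ereal \<bar>a n + \<tau> - a (\<sigma> n)\<bar>) < ereal \<epsilon>}"

definition almost_periodic_set :: "(int \<Rightarrow> real) \<Rightarrow> bool" where
  "almost_periodic_set a \<longleftrightarrow>
    locally_finite_seq a \<and> (\<forall>\<epsilon>>0. relatively_dense (set_almost_periods a \<epsilon>))"

text \<open>
  The limit as the length \<open>l\<close> of the half-open interval \<open>{x..<x + l}\<close> tends to infinity,
  regardless of its position \<open>x\<close>, i.e. uniformly in \<open>x\<close>.
\<close>

definition has_density :: "(int \<Rightarrow> real) \<Rightarrow> real \<Rightarrow> bool" where
  "has_density a d \<longleftrightarrow>
    uniform_limit UNIV (\<lambda>l x. real (card {n. a n \<in> {x..<x + l}}) / l) (\<lambda>x. d) at_top"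

definition almost_periodic_mapping :: "(int \<Rightarrow> real) \<Rightarrow> bool" where
  "almost_periodic_mapping \<phi> \<longleftrightarrow>
    (\<forall>\<epsilon>>0. relatively_dense (real_of_int ` {h. (SUP n. ereal \<bar>\<phi> (n + h) - \<phi> n\<bar>) < ereal \<epsilon>}))"

end

theory Submission
  imports Defs
begin

text \<open>
  An \<open>\<epsilon>\<close>-almost period \<open>\<tau>\<close> of the set comes with an arbitrary bijection \<open>\<sigma>\<close>. Since the enumeration
  is nondecreasing, \<open>\<sigma>\<close> can be replaced by an index shift \<open>n \<mapsto> n + h\<close> without enlarging the
  displacement (\<open>shift_of_bounded_matching\<close>): \<open>h\<close> is the net number of indices that \<open>\<sigma>\<close> carries
  across the origin, and a shift that displaced some point too far would contradict this count.

  Iterating \<open>a (n + h) \<approx> a n + \<tau>\<close> gives \<open>a (k h) \<approx> a 0 + k \<tau>\<close> with error at most \<open>k \<epsilon>\<close>. The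
  density says that \<open>m / (a m - a 0)\<close> tends to \<open>d\<close> (\<open>index_over_distance_tendsto_density\<close>), so
  that \<open>d\<close> is positive and \<open>\<bar>\<tau> - h / d\<bar> \<le> \<epsilon>\<close> (\<open>almost_period_near_shift_over_density\<close>).
  Thus \<open>\<phi> n = a n - n / d\<close> moves by at most \<open>2 \<epsilon>\<close> under the shift by \<open>h\<close>, and the shifts \<open>h\<close>, being
  within \<open>d \<epsilon>\<close> of the numbers \<open>d \<tau>\<close>, are relatively dense because the \<open>\<tau>\<close> are.
\<close>

section \<open>Net flow of a permutation of the integers across a cut\<close>

definition net_flow :: "(int \<Rightarrow> int) \<Rightarrow> int \<Rightarrow> int \<Rightarrow> int" where
  "net_flow \<sigma> p q = int (card {n. n < p \<and> q \<le> \<sigma> n}) - int (card {n. p \<le> n \<and> \<sigma> n < q})"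

lemma int_fun_step_up:
  fixes f :: "int \<Rightarrow> int"
  assumes "\<And>p. f (p + 1) = f p + 1"
  shows "f p = f 0 + p"
proof (induction p rule: int_induct[of _ 0])
  case base then show ?case by simp
next
  case (step1 i) then show ?case using assms[of i] by simp
next
  case (step2 i) then show ?case using assms[of "i - 1"] by simp
qed

lemma net_flow_source_step:
  assumes "\<And>p q. finite {n. n < p \<and> q \<le> \<sigma> n}" "\<And>p q. finite {n. p \<le> n \<and> \<sigma> n < q}"
  shows "net_flow \<sigma> (p + 1) q = net_flow \<sigma> p q + 1"
proof (cases "q \<le> \<sigma> p")
  case True
  have "{n. n < p + 1 \<and> q \<le> \<sigma> n} = insert p {n. n < p \<and> q \<le> \<sigma> n}"
    using True by auto
  moreover have "{n. p + 1 \<le> n \<and> \<sigma> n < q} = {n. p \<le> n \<and> \<sigma> n < q}"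
    using True by (auto simp: le_less)
  ultimately show ?thesis using assms(1)[of p q] by (simp add: net_flow_def)
next
  case False
  have "{n. p \<le> n \<and> \<sigma> n < q} = insert p {n. p + 1 \<le> n \<and> \<sigma> n < q}"
    using False by auto
  moreover have "{n. n < p + 1 \<and> q \<le> \<sigma> n} = {n. n < p \<and> q \<le> \<sigma> n}"
    using False by (auto simp: le_less)
  ultimately show ?thesis using assms(2)[of "p + 1" q] by (simp add: net_flow_def)
qed

lemma net_flow_target_step:
  assumes "bij \<sigma>"
    and "\<And>p q. finite {n. n < p \<and> q \<le> \<sigma> n}" "\<And>p q. finite {n. p \<le> n \<and> \<sigma> n < q}"
  shows "net_flow \<sigma> p (q + 1) = net_flow \<sigma> p q - 1"
proof -
  obtain j where j: "\<sigma> j = q" using assms(1) by (metis bij_pointE)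
  have uniq: "\<And>n. \<sigma> n = q \<longleftrightarrow> n = j" using assms(1) j by (metis bij_pointE)
  have le_iff: "\<And>n. q \<le> \<sigma> n \<longleftrightarrow> n = j \<or> q + 1 \<le> \<sigma> n" using uniq by force
  have less_iff: "\<And>n. \<sigma> n < q + 1 \<longleftrightarrow> n = j \<or> \<sigma> n < q" using uniq by force
  show ?thesis
  proof (cases "j < p")
    case True
    have "{n. n < p \<and> q \<le> \<sigma> n} = insert j {n. n < p \<and> q + 1 \<le> \<sigma> n}"
      using True le_iff by auto
    moreover have "{n. p \<le> n \<and> \<sigma> n < q + 1} = {n. p \<le> n \<and> \<sigma> n < q}"
      using True less_iff by auto
    ultimately show ?thesis using assms(2)[of p "q + 1"] j by (simp add: net_flow_def)
  next
    case False
    have "{n. p \<le> n \<and> \<sigma> n < q + 1} = insert j {n. p \<le> n \<and> \<sigma> n < q}"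
      using False less_iff by auto
    moreover have "{n. n < p \<and> q + 1 \<le> \<sigma> n} = {n. n < p \<and> q \<le> \<sigma> n}"
      using False le_iff by auto
    ultimately show ?thesis using assms(3)[of p q] j by (simp add: net_flow_def)
  qed
qed

text \<open>
  Moving the source cut up by one index releases one more index, and moving the target cut up
  absorbs one more, so the flow depends only on the distance of the two cuts.
\<close>

lemma net_flow_eq:
  assumes "bij \<sigma>"
    and "\<And>p q. finite {n. n < p \<and> q \<le> \<sigma> n}" "\<And>p q. finite {n. p \<le> n \<and> \<sigma> n < q}"
  shows "net_flow \<sigma> p q = net_flow \<sigma> 0 0 + p - q"
proof -
  have "net_flow \<sigma> p q = net_flow \<sigma> 0 q + p"
    by (rule int_fun_step_up) (rule net_flow_source_step[OF assms(2,3)])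
  moreover have "- net_flow \<sigma> 0 q = - net_flow \<sigma> 0 0 + q"
    by (rule int_fun_step_up[of "\<lambda>q. - net_flow \<sigma> 0 q"])
      (simp add: net_flow_target_step[OF assms])
  ultimately show ?thesis by simp
qed

section \<open>Matchings of a nondecreasing sequence with a translate\<close>

lemma mono_int_step:
  fixes a :: "int \<Rightarrow> real"
  assumes "\<And>n. a n \<le> a (n + 1)"
  shows "mono a"
proof
  fix i j :: int assume "i \<le> j"
  then show "a i \<le> a j"
    by (induction j rule: int_ge_induct) (auto intro: order_trans[OF _ assms])
qed

lemma locally_finite_seq_interval:
  assumes "locally_finite_seq a"
  shows "finite {n. x \<le> a n \<and> a n \<le> y}"
proof -
  have "finite {n. a n \<in> {x..y}}"
    using assms bounded_closed_interval unfolding locally_finite_seq_def by blast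
  then show ?thesis by simp
qed

text \<open>
  The right shift is the one with zero net flow from below \<open>p\<close> to at least \<open>p + h\<close>. If it displaced
  the point with index \<open>p\<close> too far in one direction, then by monotonicity no index could cross a
  suitable pair of neighbouring cuts in that direction, whereas the flow there is \<open>1\<close> or \<open>-1\<close>.
\<close>

lemma shift_of_bounded_matching:
  fixes a :: "int \<Rightarrow> real"
  assumes "locally_finite_seq a" "mono a" "bij \<sigma>"
    and near: "\<And>n. \<bar>a n + \<tau> - a (\<sigma> n)\<bar> \<le> \<epsilon>"
  obtains h where "\<And>n. \<bar>a n + \<tau> - a (n + h)\<bar> \<le> \<epsilon>"
proof -
  have fin_up: "finite {n. n < p \<and> q \<le> \<sigma> n}" for p q
  proof (rule finite_subset)
    show "{n. n < p \<and> q \<le> \<sigma> n} \<subseteq> {n. a q - \<tau> - \<epsilon> \<le> a n \<and> a n \<le> a p}"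
    proof safe
      fix n assume n: "n < p" "q \<le> \<sigma> n"
      show "a n \<le> a p" using n assms(2) by (simp add: monoD)
      have "a q \<le> a (\<sigma> n)" using n assms(2) by (simp add: monoD)
      then show "a q - \<tau> - \<epsilon> \<le> a n" using near[of n] by linarith
    qed
  qed (rule locally_finite_seq_interval[OF assms(1)])
  have fin_down: "finite {n. p \<le> n \<and> \<sigma> n < q}" for p q
  proof (rule finite_subset)
    show "{n. p \<le> n \<and> \<sigma> n < q} \<subseteq> {n. a p \<le> a n \<and> a n \<le> a q - \<tau> + \<epsilon>}"
    proof safe
      fix n assume n: "p \<le> n" "\<sigma> n < q"
      show "a p \<le> a n" using n assms(2) by (simp add: monoD)
      have "a (\<sigma> n) \<le> a q" using n assms(2) by (simp add: monoD)
      then show "a n \<le> a q - \<tau> + \<epsilon>" using near[of n] by linarith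
    qed
  qed (rule locally_finite_seq_interval[OF assms(1)])
  define h where "h = net_flow \<sigma> 0 0"
  have flow: "net_flow \<sigma> p q = h + p - q" for p q
    unfolding h_def by (rule net_flow_eq[OF assms(3) fin_up fin_down])
  have "a (p + h) \<le> a p + \<tau> + \<epsilon>" for p
  proof (rule ccontr)
    assume far: "\<not> ?thesis"
    have "\<sigma> n < p + h" if "n < p + 1" for n
    proof (rule ccontr)
      assume "\<not> \<sigma> n < p + h"
      then have "a (p + h) \<le> a (\<sigma> n)" "a n \<le> a p" using that assms(2) by (simp_all add: monoD)
      then show False using far near[of n] by linarith
    qed
    then have "{n. n < p + 1 \<and> p + h \<le> \<sigma> n} = {}" by force
    then have "net_flow \<sigma> (p + 1) (p + h) \<le> 0"
      by (simp only: net_flow_def card.empty)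
    then show False using flow[of "p + 1" "p + h"] by simp
  qed
  moreover have "a p + \<tau> - \<epsilon> \<le> a (p + h)" for p
  proof (rule ccontr)
    assume far: "\<not> ?thesis"
    have "p + h + 1 \<le> \<sigma> n" if "p \<le> n" for n
    proof (rule ccontr)
      assume "\<not> p + h + 1 \<le> \<sigma> n"
      then have "a (\<sigma> n) \<le> a (p + h)" "a p \<le> a n" using that assms(2) by (simp_all add: monoD)
      then show False using far near[of n] by linarith
    qed
    then have "{n. p \<le> n \<and> \<sigma> n < p + h + 1} = {}" by force
    then have "0 \<le> net_flow \<sigma> p (p + h + 1)"
      by (simp only: net_flow_def card.empty)
    then show False using flow[of p "p + h + 1"] by simp
  qed
  ultimately have "\<bar>a n + \<tau> - a (n + h)\<bar> \<le> \<epsilon>" for n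
    by (smt (verit))
  then show ?thesis by (rule that)
qed

lemma shift_of_set_almost_period:
  fixes a :: "int \<Rightarrow> real"
  assumes "locally_finite_seq a" "mono a" "\<tau> \<in> set_almost_periods a \<epsilon>"
  obtains h where "\<And>n. \<bar>a n + \<tau> - a (n + h)\<bar> \<le> \<epsilon>"
proof -
  obtain \<sigma> :: "int \<Rightarrow> int" where \<sigma>: "bij \<sigma>"
    and sup: "(SUP n. ereal \<bar>a n + \<tau> - a (\<sigma> n)\<bar>) < ereal \<epsilon>"
    using assms(3) unfolding set_almost_periods_def by blast
  have "\<bar>a n + \<tau> - a (\<sigma> n)\<bar> \<le> \<epsilon>" for n
  proof -
    have "ereal \<bar>a n + \<tau> - a (\<sigma> n)\<bar> \<le> (SUP n. ereal \<bar>a n + \<tau> - a (\<sigma> n)\<bar>)"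
      by (rule SUP_upper) simp
    then have "ereal \<bar>a n + \<tau> - a (\<sigma> n)\<bar> < ereal \<epsilon>" using sup by (rule le_less_trans)
    then show ?thesis by simp
  qed
  then show ?thesis using shift_of_bounded_matching[OF assms(1,2) \<sigma>] that by blast
qed

section \<open>Density and the growth of the sequence\<close>

lemma locally_finite_mono_at_top:
  assumes "locally_finite_seq a" "mono a"
  shows "filterlim (\<lambda>m. a (int m)) at_top sequentially"
  unfolding filterlim_at_top
proof
  fix B
  have "finite {n. a 0 \<le> a n \<and> a n \<le> B}" by (rule locally_finite_seq_interval[OF assms(1)])
  moreover have "infinite (range int)" by (simp add: finite_image_iff)
  ultimately obtain k where "int k \<notin> {n. a 0 \<le> a n \<and> a n \<le> B}"
    by (meson finite_subset image_subsetI)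
  moreover have "a 0 \<le> a (int k)" using assms(2) by (simp add: monoD)
  ultimately have k: "B < a (int k)" by simp
  have "B \<le> a (int m)" if "k \<le> m" for m
  proof -
    have "a (int k) \<le> a (int m)" using that assms(2) by (simp add: monoD)
    then show ?thesis using k by simp
  qed
  then show "eventually (\<lambda>m. B \<le> a (int m)) sequentially"
    unfolding eventually_sequentially by blast
qed

text \<open>
  The half-open interval from \<open>a 0\<close> to \<open>a m\<close> holds about \<open>m\<close> points: the points equal to \<open>a 0\<close> with
  negative index contribute a constant excess, and points equal to \<open>a m\<close> are caught by lengthening
  the interval by \<open>1\<close>. Neither correction affects the limit.
\<close>

lemma index_over_distance_tendsto_density:
  fixes a :: "int \<Rightarrow> real"
  assumes lf: "locally_finite_seq a" and mono: "mono a" and dens: "has_density a d"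
  shows "(\<lambda>m. real m / (a (int m) - a 0)) \<longlonglongrightarrow> d"
proof -
  define N where "N l = card {n. a n \<in> {a 0..<a 0 + l}}" for l
  define T where "T m = a (int m) - a 0" for m
  define c where "c = card {n. n < 0 \<and> a n = a 0}"
  have fin: "finite {n. a n \<in> {x..<y}}" for x y
    using lf bounded_subset[OF bounded_closed_interval[of x y]]
    unfolding locally_finite_seq_def by (meson atLeastLessThan_subseteq_atLeastAtMost_iff order_refl)
  have N_lim: "((\<lambda>l. real (N l) / l) \<longlongrightarrow> d) at_top"
    unfolding N_def by (rule tendsto_uniform_limitI[OF dens[unfolded has_density_def] UNIV_I])
  have "filterlim (\<lambda>m. - a 0 + a (int m)) at_top sequentially"
    by (rule filterlim_tendsto_add_at_top[OF tendsto_const locally_finite_mono_at_top[OF lf mono]])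
  then have T_lim: "filterlim T at_top sequentially"
    by (simp add: T_def[abs_def])
  have T1_lim: "filterlim (\<lambda>m. 1 + T m) at_top sequentially"
    by (rule filterlim_tendsto_add_at_top[OF tendsto_const T_lim])
  have inv_lim: "(\<lambda>m. inverse (T m)) \<longlonglongrightarrow> 0"
    by (rule tendsto_inverse_0_at_top[OF T_lim])
  have N_le: "N (T m) \<le> m + c" for m
  proof -
    have "n < int m" if "a n < a (int m)" for n
      using that mono by (meson leD leI monoD)
    moreover have "a n \<le> a 0" if "n < 0" for n
      using that mono by (simp add: monoD)
    ultimately have "{n. a n \<in> {a 0..<a 0 + T m}} \<subseteq> {0..<int m} \<union> {n. n < 0 \<and> a n = a 0}"
      by (force simp: T_def not_le intro: antisym)
    moreover have "finite {n. n < 0 \<and> a n = a 0}"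
      by (rule finite_subset[OF _ fin[of "a 0" "a 0 + 1"]]) auto
    ultimately have "N (T m) \<le> card ({0..<int m} \<union> {n. n < 0 \<and> a n = a 0})"
      unfolding N_def by (intro card_mono) auto
    also have "\<dots> \<le> m + c" unfolding c_def by (rule order_trans[OF card_Un_le]) simp
    finally show ?thesis .
  qed
  have N_ge: "m \<le> N (1 + T m)" for m
  proof -
    have "{0..<int m} \<subseteq> {n. a n \<in> {a 0..<a 0 + (1 + T m)}}"
    proof
      fix n assume "n \<in> {0..<int m}"
      then have "a 0 \<le> a n" "a n \<le> a (int m)" using mono by (simp_all add: monoD)
      then show "n \<in> {n. a n \<in> {a 0..<a 0 + (1 + T m)}}" by (simp add: T_def)
    qed
    then have "card {0..<int m} \<le> N (1 + T m)" unfolding N_def by (rule card_mono[OF fin])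
    then show ?thesis by simp
  qed
  have pos: "eventually (\<lambda>m. 0 < T m) sequentially"
    using T_lim by (simp add: filterlim_at_top_dense)
  have "(\<lambda>m. real m / T m) \<longlonglongrightarrow> d"
  proof (rule tendsto_sandwich)
    show "eventually (\<lambda>m. real (N (T m)) / T m - real c * inverse (T m) \<le> real m / T m) sequentially"
      using pos
    proof eventually_elim
      case (elim m)
      have "real (N (T m)) - real c \<le> real m" using N_le[of m] by linarith
      then have "(real (N (T m)) - real c) / T m \<le> real m / T m"
        using elim by (intro divide_right_mono) auto
      then show ?case by (simp add: divide_inverse left_diff_distrib)
    qed
    show "eventually (\<lambda>m. real m / T m \<le> real (N (1 + T m)) / (1 + T m) * (1 + inverse (T m))) sequentially"
      using pos
    proof eventually_elim
      case (elim m)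
      have "real m / T m \<le> real (N (1 + T m)) / T m"
        using N_ge[of m] elim by (intro divide_right_mono) auto
      also have "\<dots> = real (N (1 + T m)) / (1 + T m) * (1 + inverse (T m))"
      proof -
        have "1 + inverse (T m) = (1 + T m) / T m" using elim by (simp add: field_simps)
        moreover have "1 + T m \<noteq> 0" using elim by linarith
        ultimately show ?thesis by simp
      qed
      finally show ?case .
    qed
    show "(\<lambda>m. real (N (T m)) / T m - real c * inverse (T m)) \<longlonglongrightarrow> d"
      using tendsto_diff[OF filterlim_compose[OF N_lim T_lim] tendsto_mult[OF tendsto_const[of "real c"] inv_lim]]
      by simp
    show "(\<lambda>m. real (N (1 + T m)) / (1 + T m) * (1 + inverse (T m))) \<longlonglongrightarrow> d"
      using tendsto_mult[OF filterlim_compose[OF N_lim T1_lim] tendsto_add[OF tendsto_const[of 1] inv_lim]]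
      by simp
  qed
  then show ?thesis unfolding T_def .
qed

lemma iterated_shift_bound:
  fixes a :: "int \<Rightarrow> real"
  assumes "\<And>n. \<bar>a n + \<tau> - a (n + h)\<bar> \<le> \<epsilon>"
  shows "\<bar>a (int k * h) - a 0 - real k * \<tau>\<bar> \<le> real k * \<epsilon>"
proof (induction k)
  case 0 then show ?case by simp
next
  case (Suc k)
  have "a (int k * h + h) = a (int (Suc k) * h)" by (simp add: algebra_simps)
  then show ?case using Suc assms[of "int k * h"] by (simp add: algebra_simps)
qed

lemma filterlim_mult_nat_at_top:
  "0 < h \<Longrightarrow> filterlim (\<lambda>k. k * h) at_top (sequentially :: nat filter)"
  by (rule filterlim_subseq) (simp add: strict_mono_def)

text \<open>
  Relative density supplies an almost period larger than its error, whose shift is then upwards by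
  some \<open>h > 0\<close> indices; iterating it forces at least \<open>h\<close> points per length \<open>\<tau> + 1\<close>.
\<close>

lemma almost_periodic_set_density_pos:
  fixes a :: "int \<Rightarrow> real"
  assumes aps: "almost_periodic_set a" and mono: "mono a" and dens: "has_density a d"
  shows "0 < d"
proof -
  have lf: "locally_finite_seq a" using aps by (simp add: almost_periodic_set_def)
  have "relatively_dense (set_almost_periods a 1)"
    using aps zero_less_one unfolding almost_periodic_set_def by blast
  then obtain L where L: "set_almost_periods a 1 \<inter> {1<..<1 + L} \<noteq> {}"
    unfolding relatively_dense_def by blast
  then obtain \<tau> where \<tau>: "\<tau> \<in> set_almost_periods a 1" "1 < \<tau>" by auto
  obtain h where h: "\<And>n. \<bar>a n + \<tau> - a (n + h)\<bar> \<le> 1"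
    using shift_of_set_almost_period[OF lf mono \<tau>(1)] by blast
  have "a 0 < a h" using h[of 0] \<tau>(2) by simp
  then have "0 < h" using mono by (meson leD leI monoD)
  define p where "p = nat h"
  have p: "0 < p" "h = int p" using \<open>0 < h\<close> by (auto simp: p_def)
  have lim: "(\<lambda>k. real (k * p) / (a (int (k * p)) - a 0)) \<longlonglongrightarrow> d"
    by (rule filterlim_compose[OF index_over_distance_tendsto_density[OF lf mono dens]
          filterlim_mult_nat_at_top[OF p(1)]])
  have "real p / (\<tau> + 1) \<le> real (k * p) / (a (int (k * p)) - a 0)" if "1 \<le> k" for k
  proof -
    have bd: "\<bar>a (int (k * p)) - a 0 - real k * \<tau>\<bar> \<le> real k"
      using iterated_shift_bound[of a \<tau> h 1 k, OF h] p by simp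
    have "real k < real k * \<tau>" using that \<tau>(2) by simp
    then have pos: "0 < a (int (k * p)) - a 0" using bd by linarith
    have le: "a (int (k * p)) - a 0 \<le> real k * (\<tau> + 1)" using bd by (simp add: algebra_simps)
    have "real p / (\<tau> + 1) = real (k * p) / (real k * (\<tau> + 1))" using that by simp
    also have "\<dots> \<le> real (k * p) / (a (int (k * p)) - a 0)"
      using pos le by (intro divide_left_mono) auto
    finally show ?thesis .
  qed
  then have "real p / (\<tau> + 1) \<le> d" by (intro LIMSEQ_le_const[OF lim]) blast
  moreover have "0 < real p / (\<tau> + 1)" using p(1) \<tau>(2) by simp
  ultimately show ?thesis by linarith
qed

lemma almost_period_near_nat_shift_over_density:
  fixes a :: "int \<Rightarrow> real"
  assumes lf: "locally_finite_seq a" and mono: "mono a" and dens: "has_density a d" and "0 < d"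
    and shift: "\<And>n. \<bar>a n + \<tau> - a (n + int p)\<bar> \<le> \<epsilon>"
  shows "\<bar>\<tau> - real p / d\<bar> \<le> \<epsilon>"
proof -
  define Q where "Q k = (a (int (k * p)) - a 0) / real k" for k
  have "Q \<longlonglongrightarrow> real p / d"
  proof (cases "p = 0")
    case True then show ?thesis by (simp add: Q_def[abs_def])
  next
    case False
    have "(\<lambda>k. real (k * p) / (a (int (k * p)) - a 0)) \<longlonglongrightarrow> d"
      using False by (intro filterlim_compose[OF index_over_distance_tendsto_density[OF lf mono dens]
            filterlim_mult_nat_at_top]) simp
    then have "(\<lambda>k. real p * inverse (real (k * p) / (a (int (k * p)) - a 0))) \<longlonglongrightarrow> real p * inverse d"
      using \<open>0 < d\<close> by (intro tendsto_intros) auto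
    moreover have "real p * inverse (real (k * p) / (a (int (k * p)) - a 0)) = Q k" for k
      using False by (cases "k = 0") (simp_all add: Q_def field_simps)
    ultimately show ?thesis by (simp add: divide_inverse)
  qed
  then have lim: "(\<lambda>k. \<bar>\<tau> - Q k\<bar>) \<longlonglongrightarrow> \<bar>\<tau> - real p / d\<bar>" by (intro tendsto_intros)
  have "\<bar>\<tau> - Q k\<bar> \<le> \<epsilon>" if "1 \<le> k" for k
  proof -
    have "real k * \<bar>\<tau> - Q k\<bar> = \<bar>real k * (\<tau> - Q k)\<bar>" by (simp add: abs_mult)
    also have "real k * (\<tau> - Q k) = - (a (int k * int p) - a 0 - real k * \<tau>)"
      using that by (simp add: Q_def field_simps)
    also have "\<bar>\<dots>\<bar> \<le> real k * \<epsilon>"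
      using iterated_shift_bound[of a \<tau> "int p" \<epsilon> k, OF shift] by (simp only: abs_minus_cancel)
    finally show ?thesis using that by simp
  qed
  then show ?thesis by (intro LIMSEQ_le_const2[OF lim]) blast
qed

text \<open>A downward shift is the upward shift that belongs to \<open>-\<tau>\<close>.\<close>

lemma almost_period_near_shift_over_density:
  fixes a :: "int \<Rightarrow> real"
  assumes lf: "locally_finite_seq a" and mono: "mono a" and dens: "has_density a d" and "0 < d"
    and shift: "\<And>n. \<bar>a n + \<tau> - a (n + h)\<bar> \<le> \<epsilon>"
  shows "\<bar>\<tau> - real_of_int h / d\<bar> \<le> \<epsilon>"
proof (cases "0 \<le> h")
  case True
  then show ?thesis
    using almost_period_near_nat_shift_over_density[OF lf mono dens \<open>0 < d\<close>, of \<tau> "nat h" \<epsilon>] shift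
    by simp
next
  case False
  have "\<bar>a n + - \<tau> - a (n + int (nat (- h)))\<bar> \<le> \<epsilon>" for n
    using shift[of "n - h"] False by (simp add: abs_minus_commute algebra_simps)
  from almost_period_near_nat_shift_over_density[OF lf mono dens \<open>0 < d\<close> this]
  show ?thesis using False by (simp add: abs_minus_commute add.commute)
qed

section \<open>The remainder after the linear part\<close>

theorem theorem1:
  fixes a :: "int \<Rightarrow> real" and d :: real
  assumes "almost_periodic_set a"
    and "has_density a d"
    and "\<And>n. a n \<le> a (n + 1)"
  shows "\<exists>\<phi> :: int \<Rightarrow> real. almost_periodic_mapping \<phi> \<and>
    (\<forall>n. a n = real_of_int n / d + \<phi> n)"
proof -
  have lf: "locally_finite_seq a" using assms(1) by (simp add: almost_periodic_set_def)
  have mono: "mono a" using assms(3) by (rule mono_int_step)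
  have d: "0 < d" by (rule almost_periodic_set_density_pos[OF assms(1) mono assms(2)])
  define \<phi> where "\<phi> n = a n - real_of_int n / d" for n
  have "relatively_dense (real_of_int ` {h. (SUP n. ereal \<bar>\<phi> (n + h) - \<phi> n\<bar>) < ereal \<epsilon>})"
    if "0 < \<epsilon>" for \<epsilon>
  proof -
    \<comment> \<open>The shift by \<open>h\<close> costs \<open>2 * \<delta>\<close>, which must be strictly below \<open>\<epsilon>\<close>.\<close>
    define \<delta> where "\<delta> = \<epsilon> / 3"
    have \<delta>: "0 < \<delta>" "2 * \<delta> < \<epsilon>" using that by (auto simp: \<delta>_def)
    obtain L where L: "0 < L" "\<And>x. set_almost_periods a \<delta> \<inter> {x<..<x + L} \<noteq> {}"
      using assms(1) \<delta>(1) unfolding almost_periodic_set_def relatively_dense_def by blast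
    have "real_of_int ` {h. (SUP n. ereal \<bar>\<phi> (n + h) - \<phi> n\<bar>) < ereal \<epsilon>}
        \<inter> {x<..<x + d * (L + 2 * \<delta>)} \<noteq> {}" for x
    proof -
      obtain \<tau> where \<tau>: "\<tau> \<in> set_almost_periods a \<delta>" "x / d + \<delta> < \<tau>" "\<tau> < x / d + \<delta> + L"
        using L(2)[of "x / d + \<delta>"] by auto
      obtain h where h: "\<And>n. \<bar>a n + \<tau> - a (n + h)\<bar> \<le> \<delta>"
        using shift_of_set_almost_period[OF lf mono \<tau>(1)] by blast
      have near: "\<bar>\<tau> - real_of_int h / d\<bar> \<le> \<delta>"
        by (rule almost_period_near_shift_over_density[OF lf mono assms(2) d h])
      have "\<bar>\<phi> (n + h) - \<phi> n\<bar> \<le> 2 * \<delta>" for n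
        using h[of n] near by (simp add: \<phi>_def add_divide_distrib)
      then have "(SUP n. ereal \<bar>\<phi> (n + h) - \<phi> n\<bar>) \<le> ereal (2 * \<delta>)"
        by (intro SUP_least) simp
      also have "\<dots> < ereal \<epsilon>" using \<delta>(2) by simp
      finally have "(SUP n. ereal \<bar>\<phi> (n + h) - \<phi> n\<bar>) < ereal \<epsilon>" .
      moreover have "x / d < real_of_int h / d" "real_of_int h / d < x / d + (L + 2 * \<delta>)"
        using near \<tau>(2,3) by linarith+
      then have "x < real_of_int h" "real_of_int h < x + d * (L + 2 * \<delta>)"
        using d by (simp_all add: field_simps)
      ultimately show ?thesis by auto
    qed
    moreover have "0 < d * (L + 2 * \<delta>)" using d L(1) \<delta>(1) by simp
    ultimately show ?thesis unfolding relatively_dense_def by blast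
  qed
  then have "almost_periodic_mapping \<phi>" by (simp add: almost_periodic_mapping_def)
  moreover have "\<forall>n. a n = real_of_int n / d + \<phi> n" by (simp add: \<phi>_def)
  ultimately show ?thesis by blast
qed

end
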